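(* Let $G \sim G(n,q)$ for some $q = q(n)$ with $n^{-1}\log n \ll q(n) \ll n^{-2/3}$, and set $S = S(G)$. With high probability the graph $G - S$ has a near-perfect matching.
   Context: $G(n,q)$ is the binomial random graph on $n$ labelled vertices with edge probability $q$. For functions of $n$, $f \ll g$ means $f(n)/g(n) \to 0$ as $n \to \infty$; "with high probability" means with probability tending to $1$ as $n \to \infty$. A triangle-matching in a graph is a collection of vertex-disjoint triangles of the graph, and $S(G)$ denotes the set of vertices of the largest triangle-matching in $G$ (if there is more than one triangle-matching of maximum size, one of them is chosen according to some arbitrary deterministic rule). For $S \subset V(G)$, $G - S$ is the subgraph of $G$ induced by $V(G) \setminus S$. A matching $M$ in a graph is near-perfect if at most one vertex of the graph is not contained in an edge of $M$. *)

theory Defs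
  imports "HOL-Probability.Probability" "HOL-Library.Ramsey" "HOL-Library.Landau_Symbols"
begin

text \<open>A graph is a pair of a vertex set and a set of edges, an edge being a two-element vertex set.\<close>

type_synonym 'a graph = "'a set \<times> 'a set set"

abbreviation verts :: "'a graph \<Rightarrow> 'a set" where "verts \<equiv> fst"
abbreviation edges :: "'a graph \<Rightarrow> 'a set set" where "edges \<equiv> snd"

definition finite_simple_graph :: "'a graph \<Rightarrow> bool" where
  "finite_simple_graph G \<longleftrightarrow> finite (verts G) \<and> edges G \<subseteq> nsets (verts G) 2"

definition delete_verts :: "'a graph \<Rightarrow> 'a set \<Rightarrow> 'a graph" where
  "delete_verts G S = (verts G - S, {e \<in> edges G. e \<subseteq> verts G - S})"

text \<open>In a simple graph a triangle is determined by its set of three vertices.\<close>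

definition triangles :: "'a graph \<Rightarrow> 'a set set" where
  "triangles G = {t \<in> nsets (verts G) 3. nsets t 2 \<subseteq> edges G}"

definition triangle_matching :: "'a graph \<Rightarrow> 'a set set \<Rightarrow> bool" where
  "triangle_matching G M \<longleftrightarrow> M \<subseteq> triangles G \<and> pairwise disjnt M"

definition largest_triangle_matching :: "'a graph \<Rightarrow> 'a set set \<Rightarrow> bool" where
  "largest_triangle_matching G M \<longleftrightarrow> is_arg_max card (triangle_matching G) M"

text \<open>A deterministic rule selecting one of the largest triangle-matchings of every graph.\<close>

definition triangle_matching_rule :: "('a graph \<Rightarrow> 'a set set) \<Rightarrow> bool" where
  "triangle_matching_rule T \<longleftrightarrow>
     (\<forall>G. finite_simple_graph G \<longrightarrow> largest_triangle_matching G (T G))"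

definition matching :: "'a graph \<Rightarrow> 'a set set \<Rightarrow> bool" where
  "matching G M \<longleftrightarrow> M \<subseteq> edges G \<and> pairwise disjnt M"

definition near_perfect_matching :: "'a graph \<Rightarrow> 'a set set \<Rightarrow> bool" where
  "near_perfect_matching G M \<longleftrightarrow>
     matching G M \<and> (\<exists>\<^sub>\<le>\<^sub>1 v. v \<in> verts G \<and> v \<notin> \<Union>M)"

text \<open>The law of \<open>G(n,p)\<close> on the vertex set \<open>{1..n}\<close>. Only \<open>0 \<le> p \<le> 1\<close> is meaningful, since
  \<^const>\<open>bernoulli_pmf\<close> clamps its parameter to this interval.\<close>

definition binomial_random_graph :: "nat \<Rightarrow> real \<Rightarrow> nat graph pmf" where
  "binomial_random_graph n p =
     map_pmf (\<lambda>f. ({1..n}, {e \<in> nsets {1..n} 2. f e}))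
       (Pi_pmf (nsets {1..n} 2) False (\<lambda>_. bernoulli_pmf p))"

lemma finite_simple_graph_random:
  "G \<in> set_pmf (binomial_random_graph n p) \<Longrightarrow> finite_simple_graph G"
  by (auto simp: binomial_random_graph_def finite_simple_graph_def)

lemma ex_triangle_matching_rule: "\<exists>T :: 'a graph \<Rightarrow> 'a set set. triangle_matching_rule T"
proof -
  have "\<exists>M. largest_triangle_matching G M" if "finite_simple_graph G" for G :: "'a graph"
  proof -
    have "triangles G \<subseteq> Pow (verts G)"
      by (auto simp: triangles_def nsets_def)
    then have "finite (triangles G)"
      using that finite_subset unfolding finite_simple_graph_def by blast
    then have "\<forall>M. triangle_matching G M \<longrightarrow> card M < Suc (card (triangles G))"
      by (auto simp: triangle_matching_def less_Suc_eq_le intro: card_mono)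
    moreover have "triangle_matching G {}"
      by (simp add: triangle_matching_def)
    ultimately obtain M where "is_arg_max card (triangle_matching G) M"
      using ex_has_greatest_nat[of "triangle_matching G" "{}" card "Suc (card (triangles G))"]
      by (auto simp: is_arg_max_linorder dest: less_imp_le)
    then show ?thesis
      by (auto simp: largest_triangle_matching_def)
  qed
  then show ?thesis
    unfolding triangle_matching_rule_def by metis
qed

end

theory Submission
  imports Defs "HOL-Real_Asymp.Real_Asymp"
begin

text \<open>
Let \<open>d = n q\<close>, which is about the average degree of \<open>G\<close>, and let \<open>S\<close> be the set of vertices covered by
the triangle-matching. Deleting \<open>S\<close> could only do harm by removing most neighbours of some vertex. This
does not happen because \<open>S\<close> is a union of disjoint triangles. If a vertex \<open>v\<close> outside \<open>S\<close> has more than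
\<open>d / 8\<close> neighbours in \<open>S\<close>, then at least \<open>k = d / 24\<close> disjoint triangles contain a neighbour of \<open>v\<close>
(\<open>ex_spiked_triangles\<close>). Together with the edges from \<open>v\<close> to these neighbours they have \<open>4 k\<close> edges, so the
expected number of such configurations at \<open>v\<close> is at most \<open>(n\<^sup>3 q\<^sup>4)\<^sup>k / k! = (d n\<^sup>2 q\<^sup>3)\<^sup>k / k!\<close>. As \<open>n\<^sup>2 q\<^sup>3\<close>
tends to \<open>0\<close>, this is exponentially small in \<open>d\<close>, and as \<open>d\<close> is much larger than \<open>log n\<close>, a union bound
over all \<open>v\<close> is affordable (\<open>prob_spiked_triangles\<close>). Since all degrees of \<open>G\<close> are at least \<open>d / 4\<close>
(\<open>prob_small_degree\<close>), those of \<open>G - S\<close> are at least \<open>d / 8\<close>.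

Two further properties of \<open>G\<close> make \<open>G - S\<close> an expander. Small sets span few edges
(\<open>prob_dense_small_set\<close>), hence a small set \<open>A\<close> has at least \<open>|A|\<close> neighbours outside \<open>A\<close>, because otherwise
all the edges at \<open>A\<close> would lie in fewer than \<open>2 |A|\<close> vertices. And any two disjoint sets of linear size are
joined by an edge (\<open>prob_not_joined\<close>).

A graph with these two expansion properties has a near-perfect matching
(\<open>near_perfect_matching_of_expansion\<close>). Suppose that all maximum matchings miss at least two vertices. The
vertices that become missed when a maximum matching is rotated at one missed vertex form a set with fewer
outer neighbours than elements, which is therefore large (\<open>rotation_ends_poor_expansion\<close>). By Gallai's lemma
(\<open>gallai_transitive\<close>) the relation ``no maximum matching misses both'' is an equivalence on the set of
vertices missed by some maximum matching. Adjacent vertices of this set are equivalent. So each class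
is not joined to the large set of vertices that are missed together with one of its elements, and must
be small. But then the classes can be grouped into two large sets with no edge between them.
\<close>

section \<open>Maximum matchings\<close>

definition max_matching :: "'a graph \<Rightarrow> 'a set set \<Rightarrow> bool" where
  "max_matching G M \<longleftrightarrow> matching G M \<and> (\<forall>N. matching G N \<longrightarrow> card N \<le> card M)"

definition nbhd :: "'a graph \<Rightarrow> 'a set \<Rightarrow> 'a set" where
  "nbhd G A = {x \<in> verts G. \<exists>w\<in>A. {w, x} \<in> edges G}"

lemma edgeD:
  assumes "finite_simple_graph G" "e \<in> edges G"
  shows "e \<subseteq> verts G" "finite e" "card e = 2"
  using assms by (auto simp: finite_simple_graph_def nsets_def)

lemma doubleton_edgeD:
  assumes "finite_simple_graph G" "{x, y} \<in> edges G"
  shows "x \<in> verts G" "y \<in> verts G" "x \<noteq> y"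
  using edgeD[OF assms] by auto

lemma finite_edges: "finite_simple_graph G \<Longrightarrow> finite (edges G)"
  by (metis Pow_iff edgeD(1) finite_Pow_iff finite_simple_graph_def finite_subset subsetI)

lemma matching_finite: "finite_simple_graph G \<Longrightarrow> matching G M \<Longrightarrow> finite M"
  by (meson finite_edges finite_subset matching_def)

lemma matching_edgeD: "matching G M \<Longrightarrow> e \<in> M \<Longrightarrow> e \<in> edges G"
  by (auto simp: matching_def)

lemma matching_Union_subset: "finite_simple_graph G \<Longrightarrow> matching G M \<Longrightarrow> \<Union>M \<subseteq> verts G"
  by (meson Sup_least edgeD(1) matching_edgeD)

lemma matching_unique:
  "matching G M \<Longrightarrow> e \<in> M \<Longrightarrow> e' \<in> M \<Longrightarrow> x \<in> e \<Longrightarrow> x \<in> e' \<Longrightarrow> e = e'"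
  by (meson disjnt_iff matching_def pairwiseD)

lemma matching_partner:
  assumes "finite_simple_graph G" "matching G M" "x \<in> \<Union>M"
  obtains y where "{x, y} \<in> M" "x \<noteq> y"
proof -
  obtain e where e: "e \<in> M" "x \<in> e" using assms(3) by auto
  then have "card e = 2" using edgeD(3)[OF assms(1)] matching_edgeD[OF assms(2)] by blast
  then obtain a b where "e = {a, b}" "a \<noteq> b" by (meson card_2_iff)
  with e show ?thesis using that by (metis insert_commute insertE singletonD)
qed

lemma card_Union_matching:
  assumes "finite_simple_graph G" "matching G M"
  shows "card (\<Union>M) = 2 * card M"
proof -
  have "card (\<Union>M) = sum card M"
    using assms edgeD(2)[OF assms(1)] by (intro card_Union_disjoint) (auto simp: matching_def)
  also have "\<dots> = (\<Sum>e\<in>M. 2)"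
    using edgeD(3)[OF assms(1)] matching_edgeD[OF assms(2)] by (intro sum.cong) auto
  finally show ?thesis by simp
qed

lemma matching_insert:
  assumes "finite_simple_graph G" "matching G M" "{x, y} \<in> edges G" "x \<notin> \<Union>M" "y \<notin> \<Union>M"
  shows "matching G (insert {x, y} M)" "card (insert {x, y} M) = Suc (card M)"
proof -
  have "{x, y} \<notin> M" using assms(4) by auto
  then show "card (insert {x, y} M) = Suc (card M)"
    using matching_finite[OF assms(1,2)] by simp
  show "matching G (insert {x, y} M)"
    using assms(2-) by (auto simp: matching_def pairwise_insert disjnt_def)
qed

lemma max_matching_covers_edge:
  assumes "finite_simple_graph G" "max_matching G M" "{x, y} \<in> edges G" "x \<notin> \<Union>M"
  shows "y \<in> \<Union>M"
  using matching_insert[OF assms(1) _ assms(3,4)] assms(2) unfolding max_matching_def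
  by (metis Suc_n_not_le_n)

lemma matching_rotate:
  assumes "finite_simple_graph G" "matching G M" "{w, x} \<in> edges G" "w \<notin> \<Union>M" "{x, y} \<in> M"
  shows "matching G (insert {w, x} (M - {{x, y}}))"
    and "card (insert {w, x} (M - {{x, y}})) = card M"
    and "\<Union>(insert {w, x} (M - {{x, y}})) = insert w (\<Union>M) - {y}"
proof -
  have fin: "finite M" using matching_finite assms by metis
  have "x \<noteq> y" using assms by (meson doubleton_edgeD(3) matching_edgeD)
  have wy: "w \<noteq> y" using assms(4,5) by auto
  have U: "\<Union>(M - {{x, y}}) = \<Union>M - {x, y}"
    using matching_unique[OF assms(2) _ assms(5)] by blast
  have m: "matching G (M - {{x, y}})"
    using assms(2) by (auto simp: matching_def pairwise_def)
  have w: "w \<notin> \<Union>(M - {{x, y}})" "x \<notin> \<Union>(M - {{x, y}})" using U assms(4) by auto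
  show "matching G (insert {w, x} (M - {{x, y}}))"
    using matching_insert(1)[OF assms(1) m assms(3) w] .
  show "card (insert {w, x} (M - {{x, y}})) = card M"
    using matching_insert(2)[OF assms(1) m assms(3) w] fin assms(5)
    by (metis card_Suc_Diff1)
  have "x \<in> \<Union>M" using assms(5) by auto
  then show "\<Union>(insert {w, x} (M - {{x, y}})) = insert w (\<Union>M) - {y}"
    using U \<open>x \<noteq> y\<close> wy by auto
qed

lemma max_matching_cardD:
  "max_matching G M \<Longrightarrow> max_matching G N \<Longrightarrow> card M = card N"
  by (simp add: le_antisym max_matching_def)

lemma max_matchingI_card:
  "max_matching G M \<Longrightarrow> matching G N \<Longrightarrow> card N = card M \<Longrightarrow> max_matching G N"
  by (simp add: max_matching_def)

lemma ex_max_matching: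
  assumes "finite_simple_graph G"
  shows "\<exists>M. max_matching G M"
proof -
  have "\<forall>M. matching G M \<longrightarrow> card M \<le> card (edges G)"
    by (meson assms card_mono finite_edges matching_def)
  moreover have "matching G {}" by (simp add: matching_def)
  ultimately show ?thesis
    using ex_has_greatest_nat[of "matching G" "{}" card "Suc (card (edges G))"]
    by (auto simp: max_matching_def less_Suc_eq_le)
qed

section \<open>Rotations\<close>

text \<open>Starting from a matching that misses \<open>w0\<close>, repeatedly let the missed vertex take over a neighbour
\<open>x\<close> from its partner \<open>y\<close>, so that \<open>y\<close> becomes the missed vertex. All matchings obtained have the
same size, and this replaces the search along alternating paths by single exchanges.\<close>

inductive rotation :: "'a graph \<Rightarrow> 'a set set \<Rightarrow> 'a \<Rightarrow> 'a set set \<Rightarrow> 'a \<Rightarrow> bool"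
  for G M w0 where
  start: "rotation G M w0 M w0"
| step: "rotation G M w0 N w \<Longrightarrow> {w, x} \<in> edges G \<Longrightarrow> {x, y} \<in> N \<Longrightarrow>
    rotation G M w0 (insert {w, x} (N - {{x, y}})) y"

definition rotation_ends :: "'a graph \<Rightarrow> 'a set set \<Rightarrow> 'a \<Rightarrow> 'a set" where
  "rotation_ends G M w0 = {w. \<exists>N. rotation G M w0 N w}"

lemma rotation_invariant:
  assumes "finite_simple_graph G" "matching G M" "w0 \<notin> \<Union>M" "rotation G M w0 N w"
  shows "matching G N \<and> card N = card M \<and> w \<in> insert w0 (\<Union>M) \<and> \<Union>N = insert w0 (\<Union>M) - {w}"
  using assms(4)
proof induction
  case start
  then show ?case using assms by auto
next
  case (step N w x y)
  then have w: "w \<notin> \<Union>N" by auto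
  have "y \<in> \<Union>N" using step by auto
  then show ?case
    using matching_rotate[OF assms(1) _ step(2) w step(3)] step by auto
qed

text \<open>An edge of \<open>M\<close> can only disappear in a rotation, and the rotation that deletes it makes one of its
vertices the missed one. Hence outside the set of ends every matching reached still agrees with \<open>M\<close>.\<close>

lemma rotation_removed_edge:
  assumes "rotation G M w0 N w" "e \<in> M" "e \<notin> N"
  shows "e \<inter> rotation_ends G M w0 \<noteq> {}"
  using assms
proof induction
  case (step N w x y)
  have "y \<in> rotation_ends G M w0"
    using rotation.step[OF step(1-3)] by (auto simp: rotation_ends_def)
  then show ?case using step by auto
qed auto

text \<open>For a maximum matching every neighbour \<open>x\<close> of an end is covered, as otherwise the matching could be
enlarged. One more rotation makes the current partner of \<open>x\<close> an end; if that partner differs from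
the one in \<open>M\<close>, then the edge of \<open>M\<close> at \<open>x\<close> was deleted and has an end as a vertex. So if \<open>x\<close> is not
an end, its partner in \<open>M\<close> is, and taking partners injects the outer neighbourhood of the ends into
the ends other than \<open>w0\<close>.\<close>

lemma rotation_ends_poor_expansion:
  assumes G: "finite_simple_graph G" and M: "max_matching G M" and w0: "w0 \<in> verts G" "w0 \<notin> \<Union>M"
  defines "R \<equiv> rotation_ends G M w0"
  shows "R \<subseteq> verts G" "card (nbhd G R - R) < card R"
proof -
  have mM: "matching G M" using M by (simp add: max_matching_def)
  note inv = rotation_invariant[OF G mM w0(2)]
  show sub: "R \<subseteq> verts G"
  proof
    fix w assume "w \<in> R"
    then obtain N where "rotation G M w0 N w" by (auto simp: R_def rotation_ends_def)
    then have "w \<in> insert w0 (\<Union>M)" using inv by blast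
    then show "w \<in> verts G" using w0 matching_Union_subset[OF G mM] by blast
  qed
  have w0R: "w0 \<in> R" by (auto simp: R_def rotation_ends_def intro: rotation.start)
  have finR: "finite R" using sub G finite_subset by (auto simp: finite_simple_graph_def)
  have "\<exists>y\<in>R - {w0}. {x, y} \<in> M" if x: "x \<in> nbhd G R - R" for x
  proof -
    obtain w N where w: "{w, x} \<in> edges G" "rotation G M w0 N w"
      using x by (auto simp: nbhd_def R_def rotation_ends_def)
    have N: "max_matching G N" "\<Union>N = insert w0 (\<Union>M) - {w}"
      using inv[OF w(2)] max_matchingI_card[OF M] by auto
    have "x \<in> \<Union>N" using max_matching_covers_edge[OF G N(1) w(1)] N(2) by auto
    then have "x \<in> \<Union>M" using x w0R N(2) by auto
    then obtain y where y: "{x, y} \<in> M" using matching_partner[OF G mM] by metis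
    have "y \<in> R"
    proof (cases "{x, y} \<in> N")
      case True
      then show ?thesis using rotation.step[OF w(2,1)] by (auto simp: R_def rotation_ends_def)
    next
      case False
      then show ?thesis using rotation_removed_edge[OF w(2) y] x by (auto simp: R_def)
    qed
    moreover have "y \<noteq> w0" using y w0 by auto
    ultimately show ?thesis using y by auto
  qed
  then obtain f where f: "\<And>x. x \<in> nbhd G R - R \<Longrightarrow> f x \<in> R - {w0} \<and> {x, f x} \<in> M" by metis
  have "inj_on f (nbhd G R - R)"
  proof (rule inj_onI)
    fix x x' assume a: "x \<in> nbhd G R - R" "x' \<in> nbhd G R - R" "f x = f x'"
    then have "{x, f x} = {x', f x'}"
      using matching_unique[OF mM, of "{x, f x}" "{x', f x'}" "f x"] f[OF a(1)] f[OF a(2)] by auto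
    then show "x = x'" using a(3) by (metis doubleton_eq_iff)
  qed
  then have "card (nbhd G R - R) \<le> card (R - {w0})"
    using f finR by (intro card_inj_on_le[of f]) auto
  then show "card (nbhd G R - R) < card R"
    using w0R finR by (meson card_Diff1_less order_le_less_trans)
qed

section \<open>Gallai's lemma\<close>

definition deficient :: "'a graph \<Rightarrow> 'a set" where
  "deficient G = {x \<in> verts G. \<exists>N. max_matching G N \<and> x \<notin> \<Union>N}"

definition never_both_missed :: "'a graph \<Rightarrow> 'a \<Rightarrow> 'a \<Rightarrow> bool" where
  "never_both_missed G x y \<longleftrightarrow> x = y \<or> (\<forall>N. max_matching G N \<longrightarrow> x \<in> \<Union>N \<or> y \<in> \<Union>N)"

lemma never_both_missed_sym: "never_both_missed G x y \<Longrightarrow> never_both_missed G y x"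
  by (auto simp: never_both_missed_def)

text \<open>Suppose that \<open>M\<close> misses \<open>x\<close> and \<open>z\<close>, and let \<open>N\<close> be a maximum matching missing \<open>y\<close>, chosen to share
as many edges with \<open>M\<close> as possible. Then \<open>N\<close> covers \<open>x\<close> and \<open>z\<close>, so, both matchings having the same
size, \<open>M\<close> covers at least two vertices that \<open>N\<close> misses: \<open>y\<close> and some \<open>t\<close>. Moving \<open>N\<close> onto the edge of
\<open>M\<close> at \<open>t\<close> leaves \<open>y\<close> missed and increases the number of common edges. As adjacent vertices are never
both missed by a maximum matching, this shows that the graph induced on the deficient vertices has no edges between
different classes of the relation.\<close>

lemma gallai_transitive:
  assumes G: "finite_simple_graph G" and y: "y \<in> deficient G"
    and xy: "never_both_missed G x y" and yz: "never_both_missed G y z"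
  shows "never_both_missed G x z"
proof (rule ccontr)
  assume "\<not> never_both_missed G x z"
  then obtain M where M: "max_matching G M" "x \<notin> \<Union>M" "z \<notin> \<Union>M" "x \<noteq> z"
    by (auto simp: never_both_missed_def)
  have mM: "matching G M" using M by (simp add: max_matching_def)
  have xyz: "x \<noteq> y" "z \<noteq> y" using xy yz M \<open>\<not> never_both_missed G x z\<close> by auto
  have yM: "y \<in> \<Union>M" using xy xyz M by (auto simp: never_both_missed_def)
  define Q where "Q = (\<lambda>N. max_matching G N \<and> y \<notin> \<Union>N)"
  obtain N0 where N0: "Q N0" using y by (auto simp: deficient_def Q_def)
  have "\<forall>N. Q N \<longrightarrow> card (M \<inter> N) < Suc (card M)"
    by (metis G card_mono inf_le1 le_imp_less_Suc mM matching_finite)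
  then obtain N where N: "Q N" "\<And>N'. Q N' \<Longrightarrow> card (M \<inter> N') \<le> card (M \<inter> N)"
    using ex_has_greatest_nat[of Q N0 "\<lambda>N. card (M \<inter> N)" "Suc (card M)"] N0 less_imp_le by metis
  have mx: "max_matching G N" and mN: "matching G N" and yN: "y \<notin> \<Union>N"
    using N by (auto simp: Q_def max_matching_def)
  have xN: "x \<in> \<Union>N" "z \<in> \<Union>N" using xy yz xyz mx yN by (auto simp: never_both_missed_def)
  have fin: "finite (\<Union>M)" "finite (\<Union>N)" "finite M" "finite N"
    using G mM mN matching_Union_subset finite_subset matching_finite
    unfolding finite_simple_graph_def by (metis, metis, metis+)
  have "card (\<Union>M) = card (\<Union>N)"
    using card_Union_matching[OF G] mM mN max_matching_cardD[OF M(1) mx] by auto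
  then have "card (\<Union>M - \<Union>N) = card (\<Union>N - \<Union>M)"
    using fin card_Diff_subset_Int[of "\<Union>M" "\<Union>N"] card_Diff_subset_Int[of "\<Union>N" "\<Union>M"]
    by (simp add: Int_commute)
  moreover have "card {x, z} \<le> card (\<Union>N - \<Union>M)"
    using xN M fin by (intro card_mono) auto
  ultimately have "card (\<Union>M - \<Union>N) > 1" using M(4) by auto
  then obtain t where t: "t \<in> \<Union>M" "t \<notin> \<Union>N" "t \<noteq> y"
    by (metis Diff_iff One_nat_def card_le_Suc0_iff_eq fin(1) finite_Diff linorder_not_le yM yN)
  obtain s where s: "{t, s} \<in> M" using matching_partner[OF G mM t(1)] by metis
  have tsE: "{t, s} \<in> edges G" using s mM matching_edgeD by metis
  have sN: "s \<in> \<Union>N" using max_matching_covers_edge[OF G mx tsE t(2)] .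
  then obtain r where r: "{s, r} \<in> N" using matching_partner[OF G mN] by metis
  define N' where "N' = insert {t, s} (N - {{s, r}})"
  note rot = matching_rotate[OF G mN tsE t(2) r]
  have "Q N'"
    unfolding Q_def N'_def using rot(1,2) rot(3) max_matchingI_card[OF mx] t yN by auto
  moreover have "{s, r} \<notin> M"
    using matching_unique[OF mM s, of "{s, r}" s] r t by blast
  then have "M \<inter> N' = insert {t, s} (M \<inter> N)" using s by (auto simp: N'_def)
  moreover have "{t, s} \<notin> N" using t by auto
  ultimately show False using N(2)[of N'] fin by simp
qed

section \<open>Near-perfect matchings in expanding graphs\<close>

text \<open>Suppose that every maximum matching misses at least two vertices. The class of a deficient vertex
\<open>x\<close> avoids all ends of rotations that start at another vertex missed together with \<open>x\<close>. These ends
expand poorly, so there are more than \<open>3 b\<close> of them, and as no edge joins them to the class, the class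
has fewer than \<open>b\<close> vertices. The deficient vertices, more than \<open>3 b\<close> in number, then split into two
unions of classes of at least \<open>b\<close> vertices each, with no edge in between.\<close>

theorem near_perfect_matching_of_expansion:
  fixes b :: real
  assumes G: "finite_simple_graph G" and b: "b > 0"
    and exp: "\<And>A. A \<subseteq> verts G \<Longrightarrow> A \<noteq> {} \<Longrightarrow> card A \<le> 3 * b \<Longrightarrow> card A \<le> card (nbhd G A - A)"
    and join: "\<And>A B. A \<subseteq> verts G \<Longrightarrow> B \<subseteq> verts G \<Longrightarrow> disjnt A B \<Longrightarrow> b \<le> card A \<Longrightarrow> b \<le> card B
      \<Longrightarrow> \<exists>x\<in>A. \<exists>y\<in>B. {x, y} \<in> edges G"
  shows "\<exists>M. near_perfect_matching G M"
proof (rule ccontr)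
  assume no: "\<nexists>M. near_perfect_matching G M"
  define D where "D = deficient G"
  define cl where "cl x = {y \<in> D. never_both_missed G x y}" for x
  have DV: "D \<subseteq> verts G" by (auto simp: D_def deficient_def)
  have finV: "finite (verts G)" using G by (simp add: finite_simple_graph_def)
  have finD: "finite D" using DV finV finite_subset by auto
  have tr: "never_both_missed G x z"
    if "never_both_missed G x y" "never_both_missed G y z" "y \<in> D" for x y z
    using gallai_transitive[OF G] that by (auto simp: D_def)
  have edge: "never_both_missed G x y" if "{x, y} \<in> edges G" for x y
    using max_matching_covers_edge[OF G _ that] by (auto simp: never_both_missed_def)
  have no_edge: "\<not> (\<exists>y\<in>X. \<exists>z\<in>D - X. {y, z} \<in> edges G)"
    if "X \<subseteq> D" "\<And>x. x \<in> X \<Longrightarrow> cl x \<subseteq> X" for X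
  proof safe
    fix y z assume yz: "y \<in> X" "z \<in> D" "z \<notin> X" "{y, z} \<in> edges G"
    then have "z \<in> cl y" using edge by (simp add: cl_def)
    then show False using that yz by auto
  qed
  have big: "card (D - cl x) > 3 * b" if x: "x \<in> D" for x
  proof -
    obtain N where N: "max_matching G N" "x \<notin> \<Union>N" "x \<in> verts G"
      using x by (auto simp: D_def deficient_def)
    then have mN: "matching G N" by (simp add: max_matching_def)
    then have "\<not> near_perfect_matching G N" using no by auto
    then obtain z where z: "z \<in> verts G" "z \<notin> \<Union>N" "z \<noteq> x"
      using mN N(2,3) unfolding near_perfect_matching_def Uniq_def by blast
    define R where "R = rotation_ends G N z"
    note R = rotation_ends_poor_expansion[OF G N(1) z(1,2), folded R_def]
    have "R \<subseteq> D - cl x"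
    proof
      fix w assume w: "w \<in> R"
      then obtain N' where N': "rotation G N z N' w" by (auto simp: R_def rotation_ends_def)
      have inv: "max_matching G N'" "\<Union>N' = insert z (\<Union>N) - {w}" "w \<in> insert z (\<Union>N)"
        using rotation_invariant[OF G mN z(2) N'] max_matchingI_card[OF N(1)] by auto
      have "x \<noteq> w" "x \<notin> \<Union>N'" "w \<notin> \<Union>N'" using inv N z by auto
      then show "w \<in> D - cl x"
        using inv(1) w R(1) by (auto simp: D_def deficient_def cl_def never_both_missed_def)
    qed
    moreover have "card R > 3 * b"
    proof -
      have "R \<noteq> {}" using R(2) by force
      then show ?thesis using exp[OF R(1)] R(2) by linarith
    qed
    ultimately show ?thesis using card_mono[of "D - cl x" R] finD by simp
  qed
  have cl_closed: "cl y \<subseteq> cl x" if "y \<in> cl x" for x y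
    using that tr by (auto simp: cl_def)
  have small: "card (cl x) < b" if x: "x \<in> D" for x
  proof (rule ccontr)
    assume "\<not> card (cl x) < b"
    then have "\<exists>y\<in>cl x. \<exists>z\<in>D - cl x. {y, z} \<in> edges G"
      using big[OF x] b DV by (intro join) (auto simp: disjnt_def cl_def)
    then show False using no_edge[of "cl x"] cl_closed by (auto simp: cl_def)
  qed
  obtain M where M: "max_matching G M" using ex_max_matching[OF G] by auto
  then have "\<not> near_perfect_matching G M" "matching G M" using no by (auto simp: max_matching_def)
  then obtain x0 where "x0 \<in> verts G" "x0 \<notin> \<Union>M"
    unfolding near_perfect_matching_def Uniq_def by blast
  then have x0: "x0 \<in> D" using M by (auto simp: D_def deficient_def)
  \<comment> \<open>A smallest union of classes with at least \<open>b\<close> vertices has fewer than \<open>2 b\<close>, since removing one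
    class makes it smaller than \<open>b\<close>.\<close>
  define P where "P X \<longleftrightarrow> X \<subseteq> D \<and> (\<forall>x\<in>X. cl x \<subseteq> X) \<and> b \<le> card X" for X
  have Dbig: "card D > 3 * b"
    using big[OF x0] card_mono[of D "D - cl x0"] finD by simp
  have "P D" using Dbig b by (auto simp: P_def cl_def)
  then obtain X where X: "P X" "\<And>Y. P Y \<Longrightarrow> card X \<le> card Y"
    using ex_has_least_nat[of P D card] by auto
  have XD: "X \<subseteq> D" and finX: "finite X" using X finD finite_subset by (auto simp: P_def)
  have "X \<noteq> {}" using X(1) b by (auto simp: P_def)
  then obtain x where x: "x \<in> X" by auto
  have xx: "x \<in> cl x" using x XD by (auto simp: cl_def never_both_missed_def)
  have clX: "cl x \<subseteq> X" using x X by (auto simp: P_def)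
  have "card (X - cl x) < card X" using x xx finX by (intro psubset_card_mono) auto
  then have "\<not> P (X - cl x)" using X(2) by (meson linorder_not_le)
  moreover have "cl y \<subseteq> X - cl x" if y: "y \<in> X - cl x" for y
  proof -
    have "z \<notin> cl x" if "z \<in> cl y" for z
    proof
      assume "z \<in> cl x"
      then have "never_both_missed G x y"
        using that tr[of x z y] never_both_missed_sym[of G y z] by (auto simp: cl_def)
      then show False using y XD by (auto simp: cl_def)
    qed
    then show ?thesis using X(1) y by (auto simp: P_def)
  qed
  ultimately have "card (X - cl x) < b" using XD by (auto simp: P_def)
  moreover have "card X = card (X - cl x) + card (cl x)"
    using clX finX by (metis card_Diff_subset card_mono finite_subset le_add_diff_inverse2)
  ultimately have "card X < 2 * b" using small[of x] x XD by auto
  moreover have "card D = card X + card (D - X)"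
    using XD finD finX by (simp add: card_Diff_subset card_mono)
  ultimately have "b \<le> card (D - X)" using Dbig by simp
  then have "\<exists>y\<in>X. \<exists>z\<in>D - X. {y, z} \<in> edges G"
    using X(1) DV by (intro join) (auto simp: disjnt_def P_def)
  then show False using no_edge[OF XD] X(1) by (auto simp: P_def)
qed

section \<open>Expansion after deleting vertices\<close>

lemma sum_degrees_le:
  assumes G: "finite_simple_graph G" and A: "A \<subseteq> verts G" and W: "finite W"
    and AW: "A \<subseteq> W" "nbhd G A \<subseteq> W"
  shows "(\<Sum>v\<in>A. card (nbhd G {v})) \<le> 2 * card (nsets W 2 \<inter> edges G)"
proof -
  have finV: "finite (verts G)" using G by (simp add: finite_simple_graph_def)
  have finA: "finite A" using A finV finite_subset by auto
  define P where "P = (SIGMA v:A. nbhd G {v})"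
  let ?I = "nsets W 2 \<inter> edges G"
  have finI: "finite ?I" using W finite_imp_finite_nsets by blast
  have "(\<Sum>v\<in>A. card (nbhd G {v})) = card P"
    unfolding P_def using finA finV by (intro card_SigmaI[symmetric]) (auto simp: nbhd_def)
  also have "\<dots> \<le> card (\<Union>e\<in>?I. {p. {fst p, snd p} = e})"
  proof (rule card_mono)
    show "finite (\<Union>e\<in>?I. {p. {fst p, snd p} = e})"
    proof (rule finite_subset)
      show "(\<Union>e\<in>?I. {p. {fst p, snd p} = e}) \<subseteq> W \<times> W" by (auto simp: nsets_def)
    qed (use W in auto)
    show "P \<subseteq> (\<Union>e\<in>?I. {p. {fst p, snd p} = e})"
    proof
      fix p assume "p \<in> P"
      then obtain v x where p: "p = (v, x)" "v \<in> A" "{v, x} \<in> edges G" "x \<in> verts G"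
        by (auto simp: P_def nbhd_def)
      then have "x \<in> nbhd G A" by (auto simp: nbhd_def)
      then have "{v, x} \<subseteq> W" using AW p by auto
      then have "{v, x} \<in> nsets W 2" using edgeD[OF G p(3)] by (auto simp: nsets_def)
      then show "p \<in> (\<Union>e\<in>?I. {p. {fst p, snd p} = e})" using p by auto
    qed
  qed
  also have "\<dots> \<le> (\<Sum>e\<in>?I. card {p. {fst p, snd p} = e})"
    by (rule card_UN_le[OF finI])
  also have "\<dots> \<le> (\<Sum>e\<in>?I. 2)"
  proof (rule sum_mono)
    fix e assume "e \<in> ?I"
    then obtain x y where "e = {x, y}" by (auto simp: nsets_def card_2_iff)
    then have "{p. {fst p, snd p} = e} \<subseteq> {(x, y), (y, x)}"
      by (clarsimp simp: doubleton_eq_iff)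
    then have "card {p. {fst p, snd p} = e} \<le> card {(x, y), (y, x)}" by (intro card_mono) auto
    also have "\<dots> \<le> 2" using card_length[of "[(x, y), (y, x)]"] by simp
    finally show "card {p. {fst p, snd p} = e} \<le> 2" .
  qed
  finally show ?thesis by (simp add: mult.commute)
qed

lemma delete_verts_simple: "finite_simple_graph G \<Longrightarrow> finite_simple_graph (delete_verts G S)"
  by (auto simp: finite_simple_graph_def delete_verts_def nsets_def)

lemma nbhd_delete_verts:
  "v \<in> verts G - S \<Longrightarrow> nbhd (delete_verts G S) {v} = nbhd G {v} - S"
  by (auto simp: nbhd_def delete_verts_def)

text \<open>Every vertex keeps at least \<open>d / 8\<close> neighbours outside \<open>S\<close>. If a set \<open>A\<close> of at most \<open>3 b\<close> vertices had
fewer than \<open>card A\<close> outer neighbours there, then \<open>A\<close> and its neighbourhood would form a set of fewer than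
\<open>2 * card A\<close> vertices spanning at least \<open>card A * d / 16\<close> edges, against \<open>sparse\<close>.\<close>

lemma near_perfect_matching_delete_verts:
  fixes b d :: real
  assumes G: "finite_simple_graph G" and b: "b > 0"
    and deg: "\<And>v. v \<in> verts G \<Longrightarrow> d / 4 \<le> card (nbhd G {v})"
    and hit: "\<And>v. v \<in> verts G - S \<Longrightarrow> card (nbhd G {v} \<inter> S) \<le> d / 8"
    and sparse: "\<And>W. W \<subseteq> verts G \<Longrightarrow> W \<noteq> {} \<Longrightarrow> card W \<le> 6 * b
      \<Longrightarrow> card (nsets W 2 \<inter> edges G) < card W * d / 32"
    and join: "\<And>A B. A \<subseteq> verts G \<Longrightarrow> B \<subseteq> verts G \<Longrightarrow> disjnt A B \<Longrightarrow> b \<le> card A \<Longrightarrow> b \<le> card B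
      \<Longrightarrow> \<exists>x\<in>A. \<exists>y\<in>B. {x, y} \<in> edges G"
  shows "\<exists>M. near_perfect_matching (delete_verts G S) M"
proof (rule near_perfect_matching_of_expansion[where b = b])
  let ?H = "delete_verts G S"
  show H: "finite_simple_graph ?H" using G by (rule delete_verts_simple)
  show "b > 0" by fact
  have V: "verts ?H = verts G - S" by (simp add: delete_verts_def)
  have finV: "finite (verts G)" using G by (simp add: finite_simple_graph_def)
  show "\<exists>x\<in>A. \<exists>y\<in>B. {x, y} \<in> edges ?H"
    if A: "A \<subseteq> verts ?H" and B: "B \<subseteq> verts ?H" and AB: "disjnt A B" "b \<le> card A" "b \<le> card B" for A B
  proof -
    obtain x y where "x \<in> A" "y \<in> B" "{x, y} \<in> edges G" using join[of A B] A B AB V by auto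
    then show ?thesis using A B by (auto simp: delete_verts_def)
  qed
  show "card A \<le> card (nbhd ?H A - A)"
    if A: "A \<subseteq> verts ?H" "A \<noteq> {}" and cA: "card A \<le> 3 * b" for A
  proof (rule ccontr)
    assume less: "\<not> card A \<le> card (nbhd ?H A - A)"
    define W where "W = A \<union> (nbhd ?H A - A)"
    have WV: "W \<subseteq> verts G" using A V by (auto simp: W_def nbhd_def)
    have finW: "finite W" using WV finV finite_subset by auto
    have finA: "finite A" using finW by (auto simp: W_def)
    have cW: "card W \<le> 2 * card A"
      using less card_Un_le[of A "nbhd ?H A - A"] by (auto simp: W_def)
    then have "card W \<le> 6 * b" using cA by linarith
    then have sp: "card (nsets W 2 \<inter> edges G) < card W * d / 32"
      using sparse[OF WV] A by (auto simp: W_def)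
    then have "0 < card W * d / 32" by (meson of_nat_0_le_iff order_le_less_trans)
    then have d: "d > 0" by (simp add: zero_less_mult_iff)
    have "card A * (d / 8) = (\<Sum>v\<in>A. d / 8)" by simp
    also have "\<dots> \<le> (\<Sum>v\<in>A. real (card (nbhd ?H {v})))"
    proof (rule sum_mono)
      fix v assume "v \<in> A"
      then have v: "v \<in> verts G - S" using A V by auto
      have fin: "finite (nbhd G {v})" using finV by (auto simp: nbhd_def)
      have "card (nbhd G {v}) = card (nbhd G {v} \<inter> S) + card (nbhd G {v} - S)"
        using card_Int_Diff[OF fin] .
      then show "d / 8 \<le> card (nbhd ?H {v})"
        using deg[of v] hit[OF v] v by (simp add: nbhd_delete_verts)
    qed
    also have "\<dots> = real (\<Sum>v\<in>A. card (nbhd ?H {v}))" by simp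
    also have "\<dots> \<le> real (2 * card (nsets W 2 \<inter> edges ?H))"
      using sum_degrees_le[OF H A(1) finW] by (intro of_nat_mono) (auto simp: W_def)
    also have "\<dots> \<le> 2 * real (card (nsets W 2 \<inter> edges G))"
      using card_mono[of "nsets W 2 \<inter> edges G" "nsets W 2 \<inter> edges ?H"]
        finite_imp_finite_nsets[OF finW] by (auto simp: delete_verts_def)
    also have "\<dots> < 2 * (card W * d / 32)" using sp by linarith
    also have "\<dots> \<le> 2 * (real (2 * card A) * d / 32)"
      using cW d by (intro mult_left_mono divide_right_mono mult_right_mono of_nat_mono) auto
    also have "\<dots> = card A * (d / 8)" by simp
    finally show False by simp
  qed
qed

section \<open>Disjoint triangles touching a neighbourhood\<close>

text \<open>A set of \<open>k\<close> disjoint triples avoiding \<open>v\<close>, each with a marked vertex: the places where a graph may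
have \<open>k\<close> disjoint triangles, the marked vertices being neighbours of \<open>v\<close>.\<close>

definition spiked_triangles :: "'a set \<Rightarrow> 'a \<Rightarrow> nat \<Rightarrow> ('a set \<times> 'a) set set" where
  "spiked_triangles V v k = {L. L \<subseteq> (SIGMA t:nsets V 3. t) \<and> card L = k \<and>
     pairwise (\<lambda>p p'. disjnt (fst p) (fst p')) L \<and> (\<forall>p\<in>L. v \<notin> fst p)}"

definition spike_edges :: "'a \<Rightarrow> ('a set \<times> 'a) set \<Rightarrow> 'a set set" where
  "spike_edges v L = (\<Union>p\<in>L. insert {v, snd p} (nsets (fst p) 2))"

text \<open>Disjointness makes all these edges distinct; hence a configuration appears in the random graph with
probability \<open>q ^ (4 * k)\<close>.\<close>

lemma card_spike_edges:
  assumes "finite V" "L \<in> spiked_triangles V v k"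
  shows "card (spike_edges v L) = 4 * k"
proof -
  have finL: "finite L"
  proof (rule finite_subset)
    show "L \<subseteq> (SIGMA t:nsets V 3. t)" using assms by (simp add: spiked_triangles_def)
    show "finite (SIGMA t:nsets V 3. t)"
      using finite_imp_finite_nsets[OF assms(1)] by (intro finite_SigmaI) (auto simp: nsets_def)
  qed
  have L: "card (fst p) = 3" "finite (fst p)" "snd p \<in> fst p" "v \<notin> fst p" if "p \<in> L" for p
    using assms that by (auto simp: spiked_triangles_def nsets_def)
  have "card (spike_edges v L) = (\<Sum>p\<in>L. card (insert {v, snd p} (nsets (fst p) 2)))"
    unfolding spike_edges_def
  proof (rule card_UN_disjoint[OF finL])
    show "\<forall>p\<in>L. finite (insert {v, snd p} (nsets (fst p) 2))"
      using L(2) by (simp add: finite_imp_finite_nsets)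
    show "\<forall>p\<in>L. \<forall>p'\<in>L. p \<noteq> p' \<longrightarrow>
      insert {v, snd p} (nsets (fst p) 2) \<inter> insert {v, snd p'} (nsets (fst p') 2) = {}"
    proof (intro ballI impI)
      fix p p' assume p: "p \<in> L" "p' \<in> L" "p \<noteq> p'"
      then have "fst p \<inter> fst p' = {}"
        using assms by (auto simp: spiked_triangles_def pairwise_def disjnt_def)
      moreover have "nsets (fst p) 2 \<inter> nsets (fst p') 2 = {}" if "fst p \<inter> fst p' = {}"
      proof -
        have False if "e \<in> nsets (fst p) 2" "e \<in> nsets (fst p') 2" for e
          using that \<open>fst p \<inter> fst p' = {}\<close> by (auto simp: nsets_def card_2_iff)
        then show ?thesis by auto
      qed
      ultimately show "insert {v, snd p} (nsets (fst p) 2) \<inter> insert {v, snd p'} (nsets (fst p') 2) = {}"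
        using L[OF p(1)] L[OF p(2)] by (auto simp: nsets_def doubleton_eq_iff)
    qed
  qed
  also have "\<dots> = (\<Sum>p\<in>L. 4)"
  proof (rule sum.cong)
    fix p assume p: "p \<in> L"
    have "{v, snd p} \<notin> nsets (fst p) 2" using L(4)[OF p] by (auto simp: nsets_def)
    moreover have "card (nsets (fst p) 2) = 3"
      using card_nsets[of "fst p" 2] L(1)[OF p] by (simp add: choose_two)
    moreover have "finite (nsets (fst p) 2)" using L(2)[OF p] by (rule finite_imp_finite_nsets)
    ultimately show "card (insert {v, snd p} (nsets (fst p) 2)) = 4" by simp
  qed auto
  also have "\<dots> = 4 * k" using assms by (simp add: spiked_triangles_def)
  finally show ?thesis .
qed

text \<open>A triangle contains at most three neighbours of \<open>v\<close>, so a triangle-matching that covers more than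
\<open>3 * (k - 1)\<close> of them has at least \<open>k\<close> triangles touching the neighbourhood of \<open>v\<close>.\<close>

lemma ex_spiked_triangles:
  assumes G: "finite_simple_graph G" and T: "triangle_matching G T" and v: "v \<in> verts G - \<Union>T"
    and k: "3 * (k - 1) < card (nbhd G {v} \<inter> \<Union>T)"
  shows "\<exists>L\<in>spiked_triangles (verts G) v k. spike_edges v L \<subseteq> edges G"
proof -
  define K where "K = {t \<in> T. t \<inter> nbhd G {v} \<noteq> {}}"
  have finV: "finite (verts G)" using G by (simp add: finite_simple_graph_def)
  have T3: "card t = 3" "finite t" "t \<subseteq> verts G" "nsets t 2 \<subseteq> edges G" if "t \<in> T" for t
    using T that by (auto simp: triangle_matching_def triangles_def nsets_def)
  have "T \<subseteq> Pow (verts G)" using T3 by auto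
  then have finK: "finite K" using finV finite_subset[of K "Pow (verts G)"] by (auto simp: K_def)
  have "card (nbhd G {v} \<inter> \<Union>T) \<le> card (\<Union>K)"
    using finK T3 by (intro card_mono) (auto simp: K_def)
  also have "\<dots> \<le> (\<Sum>t\<in>K. card t)" by (rule card_Union_le_sum_card)
  also have "\<dots> = 3 * card K" using T3 by (simp add: K_def)
  finally have "k \<le> card K" using k by linarith
  then obtain K' where K': "K' \<subseteq> K" "card K' = k" by (meson obtain_subset_with_card_n)
  have "\<forall>t\<in>K. \<exists>a. a \<in> t \<inter> nbhd G {v}" by (auto simp: K_def)
  then obtain f where f: "\<And>t. t \<in> K \<Longrightarrow> f t \<in> t \<inter> nbhd G {v}"
    using bchoice by metis
  define L where "L = (\<lambda>t. (t, f t)) ` K'"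
  have "card L = k" using K' by (simp add: L_def card_image inj_on_def)
  moreover have "pairwise disjnt K'"
    using T K' by (auto simp: K_def triangle_matching_def intro: pairwise_subset)
  then have "pairwise (\<lambda>p p'. disjnt (fst p) (fst p')) L"
    by (auto simp: L_def pairwise_def)
  moreover have "L \<subseteq> (SIGMA t:nsets (verts G) 3. t)"
  proof
    fix p assume "p \<in> L"
    then obtain t where t: "t \<in> K" "p = (t, f t)" using K' by (auto simp: L_def)
    then have "t \<in> T" by (simp add: K_def)
    then have "t \<in> nsets (verts G) 3" using T3 by (simp add: nsets_def)
    then show "p \<in> (SIGMA t:nsets (verts G) 3. t)" using t f[OF t(1)] by simp
  qed
  moreover have "\<forall>p\<in>L. v \<notin> fst p" using v K' by (auto simp: L_def K_def)
  ultimately have "L \<in> spiked_triangles (verts G) v k" by (auto simp: spiked_triangles_def)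
  moreover have "spike_edges v L \<subseteq> edges G"
    unfolding spike_edges_def
  proof (rule UN_least)
    fix p assume "p \<in> L"
    then obtain t where t: "t \<in> K" "p = (t, f t)" using K' by (auto simp: L_def)
    then have "{v, f t} \<in> edges G" using f by (auto simp: nbhd_def)
    then show "insert {v, snd p} (nsets (fst p) 2) \<subseteq> edges G"
      using t T3(4) by (auto simp: K_def)
  qed
  ultimately show ?thesis by auto
qed

section \<open>First moments in the binomial random graph\<close>

lemma finite_set_binomial_random_graph: "finite (set_pmf (binomial_random_graph n q))"
proof (rule finite_subset)
  show "set_pmf (binomial_random_graph n q) \<subseteq> {{1..n}} \<times> Pow (nsets {1..n} 2)"
    by (auto simp: binomial_random_graph_def)
qed (simp add: finite_imp_finite_nsets)

lemma binomial_random_graphD: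
  assumes "G \<in> set_pmf (binomial_random_graph n q)"
  shows "verts G = {1..n}" "edges G \<subseteq> nsets {1..n} 2" "finite_simple_graph G"
  using assms finite_simple_graph_random[OF assms] by (auto simp: binomial_random_graph_def)

lemma expectation_prod_edges:
  fixes a b q :: real
  assumes q: "0 \<le> q" "q \<le> 1" and ab: "0 \<le> a" "0 \<le> b" and F: "F \<subseteq> nsets {1..n} 2"
  shows "measure_pmf.expectation (binomial_random_graph n q)
      (\<lambda>G. \<Prod>e\<in>F. if e \<in> edges G then a else b) = (q * a + (1 - q) * b) ^ card F"
proof -
  let ?N = "nsets {1..n::nat} 2"
  let ?g = "\<lambda>e x. if e \<in> F then (if x then a else b) else (1::real)"
  have fin: "finite ?N" by (simp add: finite_imp_finite_nsets)
  have FN: "?N \<inter> F = F" using F by auto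
  have "measure_pmf.expectation (binomial_random_graph n q) (\<lambda>G. \<Prod>e\<in>F. if e \<in> edges G then a else b)
      = measure_pmf.expectation (Pi_pmf ?N False (\<lambda>_. bernoulli_pmf q)) (\<lambda>f. \<Prod>e\<in>?N. ?g e (f e))"
  proof -
    have "(\<Prod>e\<in>F. if e \<in> ?N \<and> f e then a else b) = (\<Prod>e\<in>?N. ?g e (f e))" for f
    proof -
      have "(\<Prod>e\<in>?N. ?g e (f e)) = (\<Prod>e\<in>?N \<inter> F. if f e then a else b)"
        using fin by (simp add: prod.inter_restrict)
      also have "\<dots> = (\<Prod>e\<in>F. if e \<in> ?N \<and> f e then a else b)"
        using F by (intro prod.cong) auto
      finally show ?thesis by simp
    qed
    then show ?thesis by (simp add: binomial_random_graph_def)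
  qed
  also have "\<dots> = (\<Prod>e\<in>?N. measure_pmf.expectation (bernoulli_pmf q) (?g e))"
    using fin ab by (intro expectation_prod_Pi_pmf integrable_measure_pmf_finite) auto
  also have "\<dots> = (\<Prod>e\<in>?N. if e \<in> F then q * a + (1 - q) * b else 1)"
    using q by (intro prod.cong) (auto simp: algebra_simps)
  also have "\<dots> = (\<Prod>e\<in>?N \<inter> F. q * a + (1 - q) * b)"
    by (rule prod.inter_restrict[OF fin, symmetric])
  finally show ?thesis by (simp only: FN prod_constant)
qed

lemma prob_le_expectation:
  fixes p :: "'a pmf"
  assumes "finite (set_pmf p)" "\<And>x. x \<in> set_pmf p \<Longrightarrow> 0 \<le> Y x"
    "\<And>x. x \<in> set_pmf p \<Longrightarrow> P x \<Longrightarrow> (1::real) \<le> Y x"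
  shows "measure_pmf.prob p {x. P x} \<le> measure_pmf.expectation p Y"
proof -
  have "measure_pmf.prob p {x. P x} = measure_pmf.expectation p (indicator {x. P x})" by simp
  also have "\<dots> \<le> measure_pmf.expectation p Y"
    using assms by (intro integral_mono_AE integrable_measure_pmf_finite AE_pmfI)
      (auto simp: indicator_def)
  finally show ?thesis .
qed

lemma prob_edges_subset:
  fixes q :: real
  assumes q: "0 \<le> q" "q \<le> 1" and F: "F \<subseteq> nsets {1..n} 2"
  shows "measure_pmf.prob (binomial_random_graph n q) {G. F \<subseteq> edges G} \<le> q ^ card F"
proof -
  have "measure_pmf.prob (binomial_random_graph n q) {G. F \<subseteq> edges G}
      \<le> measure_pmf.expectation (binomial_random_graph n q)
         (\<lambda>G. \<Prod>e\<in>F. if e \<in> edges G then 1 else 0)"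
    by (intro prob_le_expectation finite_set_binomial_random_graph prod_nonneg)
       (auto intro!: prod_ge_1)
  also have "\<dots> = q ^ card F" using expectation_prod_edges[OF q _ _ F, of 1 0] by simp
  finally show ?thesis .
qed

text \<open>Exponential Markov inequality for the number of edges in \<open>F\<close>. The sign of \<open>s\<close> decides which tail is
bounded: the upper one for \<open>s > 0\<close>, the lower one for \<open>s < 0\<close>.\<close>

lemma prob_edge_count:
  fixes q s m :: real
  assumes q: "0 \<le> q" "q \<le> 1" and F: "F \<subseteq> nsets {1..n} 2"
  shows "measure_pmf.prob (binomial_random_graph n q) {G. s * m \<le> s * card (F \<inter> edges G)}
    \<le> exp (q * card F * (exp s - 1) - s * m)"
proof -
  have fin: "finite F" using F by (rule finite_subset) (simp add: finite_imp_finite_nsets)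
  have prod: "(\<Prod>e\<in>F. if e \<in> edges G then exp s else 1) = exp (s * card (F \<inter> edges G))" for G
  proof -
    have "(\<Prod>e\<in>F. if e \<in> edges G then exp s else 1) = (\<Prod>e\<in>F \<inter> edges G. exp s)"
      by (rule prod.inter_restrict[OF fin, symmetric])
    then show ?thesis by (simp add: exp_of_nat_mult[symmetric] mult.commute)
  qed
  have "measure_pmf.prob (binomial_random_graph n q) {G. s * m \<le> s * card (F \<inter> edges G)}
      \<le> measure_pmf.expectation (binomial_random_graph n q)
         (\<lambda>G. exp (- (s * m)) * (\<Prod>e\<in>F. if e \<in> edges G then exp s else 1))"
    unfolding prod by (intro prob_le_expectation finite_set_binomial_random_graph)
      (auto simp: exp_add[symmetric])
  also have "\<dots> = exp (- (s * m)) * (1 + q * (exp s - 1)) ^ card F"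
    using expectation_prod_edges[OF q _ _ F, of "exp s" 1] by (simp add: algebra_simps)
  also have "\<dots> \<le> exp (- (s * m)) * exp (q * (exp s - 1)) ^ card F"
  proof (intro mult_left_mono power_mono)
    have "0 \<le> (1 - q) + q * exp s" using q by simp
    then show "0 \<le> 1 + q * (exp s - 1)" by (simp add: algebra_simps)
  qed (auto simp: exp_ge_add_one_self)
  also have "\<dots> = exp (q * card F * (exp s - 1) - s * m)"
    by (simp add: exp_of_nat_mult[symmetric] exp_add[symmetric] algebra_simps)
  finally show ?thesis .
qed

lemma prob_Bex_le:
  assumes "finite I"
  shows "measure_pmf.prob p {x. \<exists>i\<in>I. P i x} \<le> (\<Sum>i\<in>I. measure_pmf.prob p {x. P i x})"
proof -
  have "{x. \<exists>i\<in>I. P i x} = (\<Union>i\<in>I. {x. P i x})" by auto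
  then show ?thesis using measure_UNION_le[OF assms, of "\<lambda>i. {x. P i x}" "measure_pmf p"] by simp
qed

lemma prob_mono_support:
  assumes "\<And>x. x \<in> set_pmf p \<Longrightarrow> P x \<Longrightarrow> Q x"
  shows "measure_pmf.prob p {x. P x} \<le> measure_pmf.prob p {x. Q x}"
  using assms by (intro measure_pmf.finite_measure_mono_AE AE_pmfI) auto

section \<open>Exceptional events\<close>

lemma card_edges_at_vertex:
  assumes "v \<in> {1..n}"
  shows "card {e \<in> nsets {1..n} 2. v \<in> e} = n - 1"
proof -
  have "{e \<in> nsets {1..n} 2. v \<in> e} = (\<lambda>x. {v, x}) ` ({1..n} - {v})"
    using assms by (auto simp: nsets_def card_2_iff)
  moreover have "inj_on (\<lambda>x. {v, x}) ({1..n} - {v})"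
    by (auto simp: inj_on_def doubleton_eq_iff)
  ultimately show ?thesis using assms by (simp add: card_image)
qed

lemma card_nbhd_singleton:
  assumes G: "G \<in> set_pmf (binomial_random_graph n q)"
  shows "card ({e \<in> nsets {1..n} 2. v \<in> e} \<inter> edges G) = card (nbhd G {v})"
proof -
  note G' = binomial_random_graphD[OF G]
  have "{e \<in> nsets {1..n} 2. v \<in> e} \<inter> edges G = (\<lambda>x. {v, x}) ` nbhd G {v}"
  proof safe
    fix e assume e: "e \<in> nsets {1..n} 2" "v \<in> e" "e \<in> edges G"
    then obtain x where "e = {v, x}" "x \<noteq> v" by (auto simp: nsets_def card_2_iff)
    then show "e \<in> (\<lambda>x. {v, x}) ` nbhd G {v}"
      using e doubleton_edgeD[OF G'(3)] by (auto simp: nbhd_def)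
  qed (use G'(2) doubleton_edgeD(3)[OF G'(3), of v v] in \<open>auto simp: nbhd_def\<close>)
  moreover have "inj_on (\<lambda>x. {v, x}) (nbhd G {v})"
    by (auto simp: inj_on_def doubleton_eq_iff)
  ultimately show ?thesis by (simp add: card_image)
qed

text \<open>The lower tail with \<open>s = - ln 2\<close>. The exponent is about \<open>- d / 2 + ln 2 * d / 4\<close> for \<open>d = n * q\<close>; the
bound \<open>d \<ge> 10\<close> pays for the vertex having only \<open>n - 1\<close> potential neighbours.\<close>

lemma prob_small_degree:
  fixes q :: real
  assumes q: "0 \<le> q" "q \<le> 1" and d: "10 \<le> n * q"
  shows "measure_pmf.prob (binomial_random_graph n q) {G. \<exists>v\<in>{1..n}. card (nbhd G {v}) < n * q / 4}
    \<le> n * exp (- (n * q / 4))"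
proof -
  let ?p = "binomial_random_graph n q"
  let ?d = "real n * q"
  have "measure_pmf.prob ?p {G. card (nbhd G {v}) < ?d / 4} \<le> exp (- (?d / 4))"
    if v: "v \<in> {1..n}" for v
  proof -
    let ?F = "{e \<in> nsets {1..n} 2. v \<in> e}"
    have "measure_pmf.prob ?p {G. card (nbhd G {v}) < ?d / 4}
      \<le> measure_pmf.prob ?p {G. - ln 2 * (?d / 4) \<le> - ln 2 * card (?F \<inter> edges G)}"
    proof (rule prob_mono_support)
      fix G assume "G \<in> set_pmf ?p" "card (nbhd G {v}) < ?d / 4"
      then show "- ln 2 * (?d / 4) \<le> - ln 2 * card (?F \<inter> edges G)"
        unfolding card_nbhd_singleton[OF \<open>G \<in> set_pmf ?p\<close>] by simp
    qed
    also have "\<dots> \<le> exp (q * card ?F * (exp (- ln 2) - 1) - - ln 2 * (?d / 4))"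
      by (rule prob_edge_count[OF q]) auto
    also have "q * card ?F * (exp (- ln 2) - 1) - - ln 2 * (?d / 4) = - ?d / 2 + q / 2 + ln 2 * (?d / 4)"
      unfolding card_edges_at_vertex[OF v]
      using v by (simp add: exp_minus field_simps of_nat_diff)
    also have "\<dots> \<le> - (?d / 4)"
    proof -
      have "ln 2 * (?d / 4) \<le> 25 / 36 * (?d / 4)"
        using d ln2_le_25_over_36 by (intro mult_right_mono) auto
      then show ?thesis using d q by linarith
    qed
    finally show ?thesis by simp
  qed
  then have "(\<Sum>v\<in>{1..n}. measure_pmf.prob ?p {G. card (nbhd G {v}) < ?d / 4})
      \<le> (\<Sum>v\<in>{1..n}. exp (- (?d / 4)))"
    by (rule sum_mono)
  then show ?thesis
    using prob_Bex_le[of "{1..n}" ?p "\<lambda>v G. card (nbhd G {v}) < ?d / 4"] by simp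
qed

lemma power_self_le_fact_exp: "real k ^ k \<le> fact k * exp k"
proof -
  have "real k ^ k / fact k \<le> (\<Sum>i. real k ^ i / fact i)"
    using sum_le_suminf[OF summable_exp[of "real k"], of "{k}"]
    by (simp add: field_simps)
  also have "\<dots> = exp k" by (simp add: exp_def field_simps)
  finally show ?thesis by (simp add: field_simps)
qed

lemma card_spiked_triangles:
  "finite (spiked_triangles {1..n} v k)" "card (spiked_triangles {1..n} v k) * fact k \<le> (n ^ 3) ^ k"
proof -
  let ?I = "SIGMA t:nsets {1..n} 3. t"
  have fin3: "finite (nsets {1..n} 3)" by (simp add: finite_imp_finite_nsets)
  have finI: "finite ?I" using fin3 by (intro finite_SigmaI) (auto simp: nsets_def)
  have "card ?I = (\<Sum>t\<in>nsets {1..n} 3. card t)"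
    using fin3 by (intro card_SigmaI) (auto simp: nsets_def)
  also have "\<dots> = (\<Sum>t\<in>nsets {1..n} 3. 3)" by (intro sum.cong) (auto simp: nsets_def)
  also have "\<dots> = 3 * (n choose 3)" using card_nsets[of "{1..n}" 3] by simp
  also have "\<dots> \<le> n ^ 3" using binomial_fact_pow[of n 3] by (simp add: fact_numeral)
  finally have I: "card ?I \<le> n ^ 3" .
  have sub: "spiked_triangles {1..n} v k \<subseteq> {L. L \<subseteq> ?I \<and> card L = k}"
    by (auto simp: spiked_triangles_def)
  have finL: "finite {L. L \<subseteq> ?I \<and> card L = k}" using finI by simp
  then show "finite (spiked_triangles {1..n} v k)" using sub finite_subset by blast
  have "card (spiked_triangles {1..n} v k) \<le> card ?I choose k"
    using card_mono[OF finL sub] n_subsets[OF finI, of k] by simp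
  then have "card (spiked_triangles {1..n} v k) * fact k \<le> (card ?I choose k) * fact k" by simp
  also have "\<dots> \<le> card ?I ^ k" by (rule binomial_fact_pow)
  also have "\<dots> \<le> (n ^ 3) ^ k" using I by (intro power_mono) auto
  finally show "card (spiked_triangles {1..n} v k) * fact k \<le> (n ^ 3) ^ k" .
qed

text \<open>There are at most \<open>(n ^ 3) ^ k / fact k\<close> configurations at a vertex, so the expected number present is
at most \<open>(d * (n\<^sup>2 * q ^ 3)) ^ k / fact k\<close> with \<open>d = n * q \<le> 24 * k\<close>. Since \<open>k ^ k / fact k \<le> exp k\<close>, this is
at most \<open>(exp 1 * 24 / 1000) ^ k\<close>, and the base is below \<open>exp (- 1)\<close>.\<close>

lemma prob_spiked_triangles:
  fixes q :: real
  assumes q: "0 \<le> q" "q \<le> 1" and k: "n * q \<le> 24 * real k" and n: "real n ^ 2 * q ^ 3 \<le> 1 / 1000"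
  shows "measure_pmf.prob (binomial_random_graph n q)
      {G. \<exists>v\<in>{1..n}. \<exists>L\<in>spiked_triangles {1..n} v k. spike_edges v L \<subseteq> edges G} \<le> n * exp (- real k)"
proof -
  let ?p = "binomial_random_graph n q"
  have "measure_pmf.prob ?p {G. \<exists>L\<in>spiked_triangles {1..n} v k. spike_edges v L \<subseteq> edges G}
      \<le> exp (- real k)" if v: "v \<in> {1..n}" for v
  proof -
    let ?S = "spiked_triangles {1..n} v k"
    have "measure_pmf.prob ?p {G. \<exists>L\<in>?S. spike_edges v L \<subseteq> edges G}
        \<le> (\<Sum>L\<in>?S. measure_pmf.prob ?p {G. spike_edges v L \<subseteq> edges G})"
      by (rule prob_Bex_le[OF card_spiked_triangles(1)])
    also have "\<dots> \<le> (\<Sum>L\<in>?S. q ^ (4 * k))"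
    proof (rule sum_mono)
      fix L assume L: "L \<in> ?S"
      have "spike_edges v L \<subseteq> nsets {1..n} 2"
      proof -
        have "insert {v, snd p} (nsets (fst p) 2) \<subseteq> nsets {1..n} 2" if "p \<in> L" for p
        proof -
          have L': "L \<subseteq> (SIGMA t:nsets {1..n} 3. t)" "\<forall>p\<in>L. v \<notin> fst p"
            using L by (simp_all add: spiked_triangles_def)
          then have "fst p \<in> nsets {1..n} 3" "snd p \<in> fst p" "v \<notin> fst p" using that by auto
          then have p: "fst p \<subseteq> {1..n}" "snd p \<in> fst p" "v \<notin> fst p"
            by (simp_all add: nsets_def)
          then have "{v, snd p} \<in> nsets {1..n} 2" using v by (auto simp: nsets_def card_insert_if)
          then show ?thesis using nsets_mono[OF p(1)] by auto
        qed
        then show ?thesis unfolding spike_edges_def by (rule UN_least)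
      qed
      from prob_edges_subset[OF q this]
      show "measure_pmf.prob ?p {G. spike_edges v L \<subseteq> edges G} \<le> q ^ (4 * k)"
        using card_spike_edges[OF _ L] by simp
    qed
    also have "\<dots> = card ?S * q ^ (4 * k)" by simp
    also have "\<dots> \<le> (real n ^ 3) ^ k / fact k * q ^ (4 * k)"
    proof (intro mult_right_mono)
      have "real (card ?S * fact k) \<le> real ((n ^ 3) ^ k)"
        using card_spiked_triangles(2) by (rule of_nat_mono)
      then show "real (card ?S) \<le> (real n ^ 3) ^ k / fact k"
        by (simp add: field_simps)
    qed (use q in auto)
    also have "\<dots> = ((n * q) * (real n ^ 2 * q ^ 3)) ^ k / fact k"
    proof -
      have "(real n ^ 3) ^ k * q ^ (4 * k) = (real n ^ 3 * q ^ 4) ^ k"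
        by (simp add: power_mult_distrib power_mult)
      also have "real n ^ 3 * q ^ 4 = (n * q) * (real n ^ 2 * q ^ 3)"
        by (simp add: power_def algebra_simps numeral_eq_Suc)
      finally show ?thesis by simp
    qed
    also have "\<dots> \<le> (24 * real k * (1 / 1000)) ^ k / fact k"
    proof (intro divide_right_mono power_mono)
      show "(n * q) * (real n ^ 2 * q ^ 3) \<le> 24 * real k * (1 / 1000)"
        using k n q by (intro mult_mono[of "n * q"]) simp_all
    qed (use q in simp_all)
    also have "\<dots> = (3 / 125) ^ k * (real k ^ k / fact k)"
    proof -
      have eq: "24 * real k * (1 / 1000) = 3 / 125 * real k" by simp
      show ?thesis by (subst eq) (simp only: power_mult_distrib times_divide_eq_right)
    qed
    also have "\<dots> \<le> (3 / 125) ^ k * exp k"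
      using power_self_le_fact_exp[of k] by (intro mult_left_mono) (auto simp: field_simps)
    also have "\<dots> = (3 / 125 * exp 1) ^ k"
      using exp_of_nat_mult[of k "1::real"] by (simp only: power_mult_distrib mult_1_right)
    also have "\<dots> \<le> exp (-1) ^ k"
    proof (intro power_mono)
      have "exp (1::real) * exp 1 \<le> 3 * 3" using exp_le by (intro mult_mono) auto
      then show "3 / 125 * exp 1 \<le> exp (-1::real)"
        by (simp add: exp_minus field_simps)
    qed auto
    also have "\<dots> = exp (- real k)" by (simp add: exp_of_nat_mult[symmetric])
    finally show ?thesis .
  qed
  then have "(\<Sum>v\<in>{1..n}. measure_pmf.prob ?p {G. \<exists>L\<in>spiked_triangles {1..n} v k. spike_edges v L \<subseteq> edges G})
      \<le> (\<Sum>v\<in>{1..n}. exp (- real k))"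
    by (rule sum_mono)
  then show ?thesis
    using prob_Bex_le[of "{1..n}" ?p "\<lambda>v G. \<exists>L\<in>spiked_triangles {1..n} v k. spike_edges v L \<subseteq> edges G"]
    by simp
qed

lemma sum_power_card_Pow:
  fixes x :: real
  assumes "finite V"
  shows "(\<Sum>W\<in>Pow V. x ^ card W) = (1 + x) ^ card V"
  using prod_add[OF assms, of "\<lambda>_. x" "\<lambda>_. 1"] by (simp add: add.commute)

text \<open>A set of \<open>w \<le> exp (- 64) * n\<close> vertices spans at most \<open>w * d / 2 * exp (- 64)\<close> edges on average, far fewer
than \<open>w * d / 32\<close>. In the upper tail with \<open>s = 64\<close> the mean contributes at most \<open>w * d\<close> to the exponent
and the threshold \<open>- 2 * w * d\<close>, so \<open>W\<close> fails with probability at most \<open>exp (- d) ^ w\<close>. Summed over all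
nonempty sets this gives \<open>(1 + exp (- d)) ^ n - 1\<close>.\<close>

lemma prob_dense_small_set:
  fixes q b :: real
  assumes q: "0 \<le> q" "q \<le> 1" and b: "6 * b \<le> exp (- 64) * n" and n: "n * exp (- (n * q)) \<le> 1"
  shows "measure_pmf.prob (binomial_random_graph n q)
      {G. \<exists>W\<in>Pow {1..n} - {{}}. card W \<le> 6 * b \<and> card W * (n * q) / 32 \<le> card (nsets W 2 \<inter> edges G)}
    \<le> 2 * (n * exp (- (n * q)))"
proof -
  let ?p = "binomial_random_graph n q"
  let ?d = "real n * q"
  let ?B = "\<lambda>W G. card W \<le> 6 * b \<and> card W * ?d / 32 \<le> card (nsets W 2 \<inter> edges G)"
  have *: "measure_pmf.prob ?p {G. ?B W G} \<le> exp (- ?d) ^ card W" if W: "W \<in> Pow {1..n} - {{}}" for W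
  proof (cases "card W \<le> 6 * b")
    case True
    let ?F = "nsets W 2"
    have F: "?F \<subseteq> nsets {1..n} 2" using W by (intro nsets_mono) auto
    have "measure_pmf.prob ?p {G. ?B W G}
        \<le> measure_pmf.prob ?p {G. 64 * (card W * ?d / 32) \<le> 64 * real (card (?F \<inter> edges G))}"
      by (intro prob_mono_support, elim conjE, linarith)
    also have "\<dots> \<le> exp (q * card ?F * (exp 64 - 1) - 64 * (card W * ?d / 32))"
      by (rule prob_edge_count[OF q F])
    also have "q * card ?F * (exp 64 - 1) - 64 * (card W * ?d / 32) \<le> - (card W * ?d)"
    proof -
      have "real (card ?F) = real (card W * (card W - 1) div 2)" by (simp add: choose_two)
      also have "\<dots> \<le> real (card W * card W) / 2"
      proof -
        have "card W * (card W - 1) div 2 * 2 \<le> card W * (card W - 1)" by simp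
        also have "\<dots> \<le> card W * card W" by simp
        finally have "real (card W * (card W - 1) div 2 * 2) \<le> real (card W * card W)"
          by (rule of_nat_mono)
        then show ?thesis by simp
      qed
      also have "\<dots> \<le> card W * (exp (- 64) * n)"
      proof -
        have "real (card W) * real (card W) \<le> real (card W) * (exp (- 64) * n)"
          using True b by (intro mult_left_mono) auto
        moreover have "0 \<le> real (card W) * (exp (- 64) * n)" by simp
        ultimately show ?thesis unfolding of_nat_mult by linarith
      qed
      finally have F': "real (card ?F) \<le> card W * (exp (- 64) * n)" .
      have "q * card ?F * (exp 64 - 1) \<le> q * card ?F * exp 64"
        using q by (intro mult_left_mono) auto
      also have "\<dots> \<le> q * (card W * (exp (- 64) * n)) * exp 64"
        using q F' by (intro mult_right_mono mult_left_mono) auto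
      also have "\<dots> = card W * ?d" by (simp add: exp_minus)
      finally show ?thesis by linarith
    qed
    finally show ?thesis by (simp add: exp_of_nat_mult[symmetric])
  next
    case False
    then show ?thesis by simp
  qed
  have "measure_pmf.prob ?p {G. \<exists>W\<in>Pow {1..n} - {{}}. ?B W G}
      \<le> (\<Sum>W\<in>Pow {1..n} - {{}}. measure_pmf.prob ?p {G. ?B W G})"
    by (rule prob_Bex_le) simp
  also have "\<dots> \<le> (\<Sum>W\<in>Pow {1..n} - {{}}. exp (- ?d) ^ card W)"
    using * by (rule sum_mono)
  also have "\<dots> = (1 + exp (- ?d)) ^ n - 1"
    using sum_power_card_Pow[of "{1..n}" "exp (- ?d)"]
      sum.remove[of "Pow {1..n}" "{}" "\<lambda>W. exp (- ?d) ^ card W"] by simp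
  also have "\<dots> \<le> exp (exp (- ?d)) ^ n - 1"
    by (intro diff_right_mono power_mono) (auto simp: exp_ge_add_one_self)
  also have "\<dots> = exp (n * exp (- ?d)) - 1" by (simp add: exp_of_nat_mult[symmetric])
  also have "\<dots> \<le> 2 * (n * exp (- ?d))"
  proof -
    let ?x = "n * exp (- ?d)"
    have "?x\<^sup>2 \<le> ?x" using n power_decreasing[of 1 2 ?x] by simp
    then show ?thesis using exp_bound[of ?x] n by simp
  qed
  finally show ?thesis .
qed

text \<open>Two such sets span at least \<open>b\<^sup>2\<close> pairs, and there are at most \<open>4 ^ n\<close> choices of the two sets.\<close>

lemma prob_not_joined:
  fixes q b :: real
  assumes q: "0 \<le> q" "q \<le> 1" and b: "0 \<le> b"
  shows "measure_pmf.prob (binomial_random_graph n q)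
      {G. \<exists>(A, B)\<in>Pow {1..n} \<times> Pow {1..n}. disjnt A B \<and> b \<le> card A \<and> b \<le> card B
        \<and> (\<forall>x\<in>A. \<forall>y\<in>B. {x, y} \<notin> edges G)}
    \<le> 4 ^ n * exp (- (q * b\<^sup>2 / 2))"
proof -
  let ?p = "binomial_random_graph n q"
  let ?B = "\<lambda>P G. disjnt (fst P) (snd P) \<and> b \<le> card (fst P) \<and> b \<le> card (snd P)
        \<and> (\<forall>x\<in>fst P. \<forall>y\<in>snd P. {x, y} \<notin> edges G)"
  let ?I = "Pow {1..n} \<times> Pow {1..n}"
  have *: "measure_pmf.prob ?p {G. ?B P G} \<le> exp (- (q * b\<^sup>2 / 2))" if P: "P \<in> ?I" for P
  proof (cases "disjnt (fst P) (snd P) \<and> b \<le> card (fst P) \<and> b \<le> card (snd P)")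
    case True
    let ?F = "(\<lambda>(x, y). {x, y}) ` (fst P \<times> snd P)"
    have dis: "x \<noteq> y" if "x \<in> fst P" "y \<in> snd P" for x y
      using True that by (auto simp: disjnt_def)
    have "inj_on (\<lambda>(x, y). {x, y}) (fst P \<times> snd P)"
      using dis by (auto simp: inj_on_def doubleton_eq_iff)
    then have cF: "card ?F = card (fst P) * card (snd P)"
      by (simp add: card_image card_cartesian_product)
    have F: "?F \<subseteq> nsets {1..n} 2"
      using P dis by (force simp: nsets_def card_insert_if)
    have "measure_pmf.prob ?p {G. ?B P G}
        \<le> measure_pmf.prob ?p {G. - ln 2 * 0 \<le> - ln 2 * real (card (?F \<inter> edges G))}"
    proof (intro prob_mono_support)
      fix G assume "?B P G"
      then have "?F \<inter> edges G = {}" by auto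
      then have "card (?F \<inter> edges G) = 0" by (simp only: card.empty)
      then show "- ln 2 * 0 \<le> - ln 2 * real (card (?F \<inter> edges G))" by simp
    qed
    also have "\<dots> \<le> exp (q * card ?F * (exp (- ln 2) - 1) - - ln 2 * 0)"
      by (rule prob_edge_count[OF q F])
    also have "\<dots> \<le> exp (- (q * b\<^sup>2 / 2))"
    proof -
      have "b * b \<le> real (card (fst P)) * real (card (snd P))"
        using True b by (intro mult_mono) auto
      then have "q * (b * b) \<le> q * (real (card (fst P)) * real (card (snd P)))"
        using q by (intro mult_left_mono)
      then show ?thesis unfolding cF by (simp add: exp_minus power2_eq_square)
    qed
    finally show ?thesis .
  next
    case False
    then have "{G. ?B P G} = {}" by blast
    then show ?thesis by (simp only: measure_empty exp_ge_zero)
  qed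
  have "{G. \<exists>(A, B)\<in>?I. disjnt A B \<and> b \<le> card A \<and> b \<le> card B
        \<and> (\<forall>x\<in>A. \<forall>y\<in>B. {x, y} \<notin> edges G)} = {G. \<exists>P\<in>?I. ?B P G}"
    by (simp add: split_beta)
  also have "measure_pmf.prob ?p {G. \<exists>P\<in>?I. ?B P G} \<le> (\<Sum>P\<in>?I. measure_pmf.prob ?p {G. ?B P G})"
    by (rule prob_Bex_le) simp
  also have "\<dots> \<le> (\<Sum>P\<in>?I. exp (- (q * b\<^sup>2 / 2)))"
    using * by (rule sum_mono)
  also have "\<dots> = 4 ^ n * exp (- (q * b\<^sup>2 / 2))"
    by (simp add: card_cartesian_product card_Pow power_mult_distrib[symmetric])
  finally show ?thesis .
qed


section \<open>Near-perfect matchings outside the triangle-matching\<close>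

text \<open>The four exceptional events with sets of size \<open>b = \<beta> * n\<close>, where \<open>\<beta>\<close> makes \<open>6 * b = exp (- 64) * n\<close> the
bound for sparse sets, and with \<open>k\<close> just large enough for \<open>d / 8\<close> neighbours covered by triangles. The
condition \<open>d \<ge> 48 * ln n\<close> gives \<open>n * exp (- d / 24) \<le> 1 / n\<close>, which serves the unions over vertices and the sparse sets;
\<open>d * \<beta>\<^sup>2 \<ge> 6\<close> makes the exponent \<open>q * b\<^sup>2 / 2\<close> at least \<open>3 * n\<close>, enough against the \<open>4 ^ n\<close> pairs of sets.\<close>

lemma prob_no_near_perfect_matching:
  fixes q :: real and n :: nat
  defines "\<beta> \<equiv> exp (- 64) / 6 :: real"
  assumes q: "0 \<le> q" "q \<le> 1" and T: "triangle_matching_rule T" and n: "1 \<le> n"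
    and d_ln: "48 * ln n \<le> n * q" and d: "10 \<le> n * q" "6 / \<beta>\<^sup>2 \<le> n * q"
    and few: "real n ^ 2 * q ^ 3 \<le> 1 / 1000"
  shows "measure_pmf.prob (binomial_random_graph n q)
      {G. \<nexists>M. near_perfect_matching (delete_verts G (\<Union>(T G))) M} \<le> 5 / n"
proof -
  let ?p = "binomial_random_graph n q"
  let ?d = "real n * q"
  define b where "b = \<beta> * n"
  define k where "k = nat \<lceil>?d / 24\<rceil>"
  have \<beta>: "\<beta> > 0" by (simp add: \<beta>_def)
  have b: "b > 0" using n \<beta> by (simp add: b_def)
  have k: "?d / 24 \<le> k" "real k - 1 < ?d / 24" "1 \<le> k"
    unfolding k_def using d by linarith+
  define E1 where "E1 = {G. \<exists>v\<in>{1..n}. card (nbhd G {v}) < ?d / 4}"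
  define E2 where "E2 = {G :: nat graph. \<exists>v\<in>{1..n}. \<exists>L\<in>spiked_triangles {1..n} v k. spike_edges v L \<subseteq> edges G}"
  define E3 where "E3 = {G :: nat graph. \<exists>W\<in>Pow {1..n} - {{}}. card W \<le> 6 * b \<and>
    card W * ?d / 32 \<le> card (nsets W 2 \<inter> edges G)}"
  define E4 where "E4 = {G :: nat graph. \<exists>(A, B)\<in>Pow {1..n} \<times> Pow {1..n}. disjnt A B \<and> b \<le> card A \<and> b \<le> card B
        \<and> (\<forall>x\<in>A. \<forall>y\<in>B. {x, y} \<notin> edges G)}"
  have good: "\<exists>M. near_perfect_matching (delete_verts G (\<Union>(T G))) M"
    if G: "G \<in> set_pmf ?p" and nE: "G \<notin> E1 \<union> E2 \<union> E3 \<union> E4" for G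
  proof (rule near_perfect_matching_delete_verts[where d = ?d])
    note G' = binomial_random_graphD[OF G]
    show "finite_simple_graph G" "b > 0" by fact+
    show "?d / 4 \<le> card (nbhd G {v})" if "v \<in> verts G" for v
      using nE that G'(1) by (force simp: E1_def)
    have TG: "triangle_matching G (T G)"
      using T[unfolded triangle_matching_rule_def, rule_format, OF G'(3)]
      by (simp add: largest_triangle_matching_def is_arg_max_def)
    show "card (nbhd G {v} \<inter> \<Union>(T G)) \<le> ?d / 8" if v: "v \<in> verts G - \<Union>(T G)" for v
    proof (rule ccontr)
      assume "\<not> card (nbhd G {v} \<inter> \<Union>(T G)) \<le> ?d / 8"
      then have "real (3 * (k - 1)) < card (nbhd G {v} \<inter> \<Union>(T G))"
        using k by (simp add: of_nat_diff)
      then have "3 * (k - 1) < card (nbhd G {v} \<inter> \<Union>(T G))" by linarith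
      from ex_spiked_triangles[OF G'(3) TG v this] show False
        using nE v unfolding G'(1) E2_def by blast
    qed
    show "card (nsets W 2 \<inter> edges G) < card W * ?d / 32"
      if "W \<subseteq> verts G" "W \<noteq> {}" "card W \<le> 6 * b" for W
    proof (rule ccontr)
      assume "\<not> card (nsets W 2 \<inter> edges G) < card W * ?d / 32"
      then have "G \<in> E3" using that unfolding G'(1) E3_def by (auto simp: not_less)
      then show False using nE by simp
    qed
    show "\<exists>x\<in>A. \<exists>y\<in>B. {x, y} \<in> edges G"
      if "A \<subseteq> verts G" "B \<subseteq> verts G" "disjnt A B" "b \<le> card A" "b \<le> card B" for A B
    proof (rule ccontr)
      assume "\<not> (\<exists>x\<in>A. \<exists>y\<in>B. {x, y} \<in> edges G)"
      then have "G \<in> E4" using that unfolding G'(1) E4_def by blast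
      then show False using nE by simp
    qed
  qed
  have exp_d: "n * exp (- (?d / 24)) \<le> 1 / n"
  proof -
    have "exp (- (?d / 24)) \<le> exp (- (2 * ln n))" using d_ln by simp
    also have "\<dots> = 1 / n ^ 2"
      using n by (simp add: exp_minus exp_double inverse_eq_divide)
    finally have "n * exp (- (?d / 24)) \<le> n * (1 / n ^ 2)" by (intro mult_left_mono) auto
    also have "\<dots> = 1 / n" using n by (simp add: power2_eq_square)
    finally show ?thesis .
  qed
  have exp_d': "n * exp (- x) \<le> 1 / n" if "?d / 24 \<le> x" for x
    using mult_left_mono[of "exp (- x)" "exp (- (?d / 24))" n] that exp_d by simp
  have 1: "measure_pmf.prob ?p E1 \<le> 1 / n"
  proof -
    have "?d / 24 \<le> ?d / 4" using d by linarith
    from prob_small_degree[OF q d(1)] exp_d'[OF this] show ?thesis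
      unfolding E1_def by (rule order_trans)
  qed
  have 2: "measure_pmf.prob ?p E2 \<le> 1 / n"
  proof -
    have "?d \<le> 24 * real k" using k by simp
    from prob_spiked_triangles[OF q this few] exp_d'[OF k(1)] show ?thesis
      unfolding E2_def by (rule order_trans)
  qed
  have 3: "measure_pmf.prob ?p E3 \<le> 2 / n"
  proof -
    have "?d / 24 \<le> ?d" using d by linarith
    then have a: "n * exp (- ?d) \<le> 1 / n" by (rule exp_d')
    also have "\<dots> \<le> 1" using n by simp
    finally have "n * exp (- ?d) \<le> 1" .
    then have "measure_pmf.prob ?p E3 \<le> 2 * (n * exp (- ?d))"
      unfolding E3_def by (intro prob_dense_small_set[OF q]) (simp_all add: b_def \<beta>_def)
    then show ?thesis using a by simp
  qed
  have 4: "measure_pmf.prob ?p E4 \<le> 1 / n"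
  proof -
    have "measure_pmf.prob ?p E4 \<le> 4 ^ n * exp (- (q * b\<^sup>2 / 2))"
      unfolding E4_def using b by (intro prob_not_joined[OF q]) simp
    also have "\<dots> = exp (n * ln 4) * exp (- (n * (?d * \<beta>\<^sup>2 / 2)))"
      by (simp add: exp_of_nat_mult b_def power2_eq_square algebra_simps)
    also have "\<dots> \<le> exp (n * 2) * exp (- (n * 3))"
    proof -
      have "ln 4 = 2 * ln (2::real)" using ln_realpow[of 2 2] by simp
      then have "ln 4 \<le> (2::real)" using ln2_le_25_over_36 by simp
      moreover have "6 \<le> ?d * \<beta>\<^sup>2" using d(2) \<beta> by (simp add: field_simps)
      ultimately show ?thesis using n by (intro mult_mono) auto
    qed
    also have "\<dots> = exp (- real n)" by (simp add: exp_add[symmetric])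
    also have "\<dots> \<le> 1 / n"
    proof -
      have "real n \<le> exp n" using exp_ge_add_one_self[of n] by linarith
      then show ?thesis using n by (simp add: exp_minus field_simps)
    qed
    finally show ?thesis .
  qed
  have "measure_pmf.prob ?p {G. \<nexists>M. near_perfect_matching (delete_verts G (\<Union>(T G))) M}
      \<le> measure_pmf.prob ?p {G. G \<in> E1 \<union> E2 \<union> E3 \<union> E4}"
    using good by (intro prob_mono_support) blast
  also have "\<dots> \<le> measure_pmf.prob ?p (E1 \<union> E2 \<union> E3) + measure_pmf.prob ?p E4"
    unfolding Collect_mem_eq by (intro measure_Un_le) simp_all
  also have "\<dots> \<le> measure_pmf.prob ?p (E1 \<union> E2) + measure_pmf.prob ?p E3 + measure_pmf.prob ?p E4"
    by (intro add_right_mono measure_Un_le) simp_all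
  also have "\<dots> \<le> measure_pmf.prob ?p E1 + measure_pmf.prob ?p E2 + measure_pmf.prob ?p E3 + measure_pmf.prob ?p E4"
    by (intro add_right_mono measure_Un_le) simp_all
  also have "\<dots> \<le> 5 / n" using 1 2 3 4 by simp
  finally show ?thesis .
qed

theorem theorem1p5:
  fixes q :: "nat \<Rightarrow> real"
    and T :: "nat graph \<Rightarrow> nat set set"
  assumes "\<And>n. 0 \<le> q n \<and> q n \<le> 1"
    and "(\<lambda>n. ln (real n) / real n) \<in> o(q)"
    and "q \<in> o(\<lambda>n. real n powr (- 2 / 3))"
    and "triangle_matching_rule T"
  shows "(\<lambda>n. measure_pmf.prob (binomial_random_graph n (q n))
            {G. let S = \<Union>(T G) in \<exists>M. near_perfect_matching (delete_verts G S) M})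
         \<longlonglongrightarrow> 1"
proof -
  let ?good = "\<lambda>G. \<exists>M. near_perfect_matching (delete_verts G (\<Union>(T G))) M"
  let ?\<beta> = "exp (- 64) / 6 :: real"
  \<comment> \<open>As \<open>ln n \<ge> 1\<close> eventually, \<open>n * q n \<ge> C * ln n\<close> yields all lower bounds needed on \<open>n * q n\<close>.\<close>
  define C where "C = 10 + 6 / ?\<beta>\<^sup>2 + 48"
  have C: "C > 0" "C \<ge> 48" "C \<ge> 10" "C \<ge> 6 / ?\<beta>\<^sup>2" by (simp_all add: C_def add_pos_nonneg)
  have ln_ge_1: "\<forall>\<^sub>F n in sequentially. 1 \<le> ln (real n)"
    by real_asymp
  have "\<forall>\<^sub>F n in sequentially. norm (ln (real n) / real n) \<le> 1 / C * norm (q n)"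
    using landau_o.smallD[OF assms(2), of "1 / C"] C by simp
  moreover have "\<forall>\<^sub>F n in sequentially. norm (q n) \<le> 1 / 10 * norm (real n powr (- 2 / 3))"
    using landau_o.smallD[OF assms(3), of "1 / 10"] by simp
  ultimately have bad: "\<forall>\<^sub>F n in sequentially.
      measure_pmf.prob (binomial_random_graph n (q n)) {G. \<not> ?good G} \<le> 5 / n"
    using ln_ge_1 eventually_gt_at_top[of 0]
  proof eventually_elim
    case (elim n)
    have q: "0 \<le> q n" "q n \<le> 1" using assms(1) by auto
    have "C * ln n \<le> n * q n" using elim q C by (simp add: field_simps)
    moreover have "48 * ln n \<le> C * ln n" "C * 1 \<le> C * ln n"
      using elim C by (intro mult_right_mono mult_left_mono; simp)+
    ultimately have d: "48 * ln n \<le> n * q n" "C \<le> n * q n" by linarith+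
    have "real n ^ 2 * q n ^ 3 \<le> real n ^ 2 * (1 / 10 * real n powr (- 2 / 3)) ^ 3"
      using elim q by (intro mult_left_mono power_mono) auto
    also have "\<dots> = 1 / 1000"
    proof -
      have "(real n powr (- 2 / 3)) ^ 3 = real n powr (- 2)"
        using elim by (simp add: powr_realpow[symmetric] powr_powr)
      also have "\<dots> = 1 / real n ^ 2"
        using elim by (simp add: powr_minus powr_realpow inverse_eq_divide)
      finally show ?thesis using elim by (simp add: power_divide)
    qed
    finally have few: "real n ^ 2 * q n ^ 3 \<le> 1 / 1000" .
    have "1 \<le> n" "10 \<le> n * q n" "6 / ?\<beta>\<^sup>2 \<le> n * q n" using elim d C by linarith+
    then show ?case
      using prob_no_near_perfect_matching[OF q assms(4) _ d(1) _ _ few] by blast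
  qed
  have compl: "measure_pmf.prob (binomial_random_graph n (q n)) {G. ?good G}
      = 1 - measure_pmf.prob (binomial_random_graph n (q n)) {G. \<not> ?good G}" for n
  proof -
    have "{G. ?good G} = UNIV - {G. \<not> ?good G}" by blast
    then show ?thesis
      using measure_pmf.prob_compl[of "{G. \<not> ?good G}" "binomial_random_graph n (q n)"] by simp
  qed
  have "(\<lambda>n. measure_pmf.prob (binomial_random_graph n (q n)) {G. ?good G}) \<longlonglongrightarrow> 1"
  proof (rule tendsto_sandwich)
    show "\<forall>\<^sub>F n in sequentially.
        1 - 5 / real n \<le> measure_pmf.prob (binomial_random_graph n (q n)) {G. ?good G}"
      unfolding compl using bad by (rule eventually_mono) linarith
    show "\<forall>\<^sub>F n in sequentially. measure_pmf.prob (binomial_random_graph n (q n)) {G. ?good G} \<le> 1"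
      by (intro always_eventually allI measure_pmf.prob_le_1)
    show "(\<lambda>n. 1 - 5 / real n) \<longlonglongrightarrow> 1" by real_asymp
  qed (rule tendsto_const)
  then show ?thesis by (simp only: Let_def)
qed

end
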